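(* Let $\Sigma\subseteq\mathcal Q$ and let $\mu$ be an action. Then there exists $\Sigma'$ such that for every configuration $\mathcal C$ with $(\Sigma'',\Sigma)\vdash\mathcal C$ (for some $\Sigma''$), every scheduler $s$ and every $\Delta\in\mathcal D(\mathit{Conf})$ with $\mathcal C\xrightarrow{\mu}_s\Delta$, it holds that $(\Sigma'',\Sigma')\vdash\Delta$.
   Context: Notation. For a set $S$, $\mathcal D(S)$ is the set of finitely supported probability distributions on $S$; $\overline{s}$ is the point distribution at $s$; $\sum_{i}p_i\bullet\Delta_i$ is a convex combination of distributions. Qubit names range over a denumerable set $\mathcal Q$; for a finite $\Sigma\subseteq\mathcal Q$, $\mathcal H_\Sigma=(\mathbb C^2)^{\otimes|\Sigma|}$. A superoperator with Kraus operators $\{E_i\}$ maps $\rho\mapsto\sum_iE_i\rho E_i^\dagger$; trace-preserving if $\sum_iE_i^\dagger E_i=\mathbb I$. A measurement is $\mathbb M=\{M_m\}_{m=0}^{k-1}$ with $\sum_mM_m^\dagger M_m=\mathbb I$, and $\mathcal M_m(\sigma)=M_m\sigma M_m^\dagger$. $\mathcal E^{\tilde q}$ applies $\mathcal E$ to qubits $\tilde q$ and the identity to the others. Syntax (tagged lqCCS). Tags $t$ from a denumerable set $\mathit{Tag}$; each channel $c$ has a type $\widehat{\mathbb N}$, $\widehat{\mathbb B}$ or $\widehat{\mathcal Q}$. Processes: $P::=t:\tau.P\mid (t,t'):\tau.P\mid t:\mathcal E(\tilde e).P\mid t:\mathbb M(\tilde e\rhd x).P\mid t:c?x.P\mid \mathbf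 0_{\tilde e}\mid t:c!e.P\mid \mathrm{if}\ e\ \mathrm{then}\ P\ \mathrm{else}\ P\mid P+P\mid P\parallel P\mid P\setminus c$, expressions $e::=x\mid b\mid n\mid q\mid\neg e\mid e\lor e\mid e\le e\mid e=e$, $\mathcal E$ a trace-preserving superoperator, $\mathbb M$ a measurement. Closed expressions evaluate, $e\Downarrow v$, to values (naturals, Booleans, qubit names). Typing. $\Sigma\vdash\mathbf 0_{\tilde e}$ if $\tilde e$ enumerates $\Sigma$; $\tau$-prefixes and restriction keep the context of the continuation; sum and if-then-else require both branches typed by $\Sigma$; $\Sigma\vdash t:\mathcal E(\tilde e).P$ and $\Sigma\vdash t:\mathbb M(\tilde e\rhd y).P$ if $\tilde e$ enumerates $E\subseteq\Sigma$ of size the arity and $\Sigma\vdash P$; classical send/receive: $\Sigma\vdash P$; $\Sigma\vdash t:c?x.P$ with $c:\widehat{\mathcal Q}$ if $\Sigma\cup\{x\}\vdash P$; $\Sigma\vdash t:c!e.P$ with $c:\widehat{\mathcal Q}$ if $e\in\Sigma$ and $\Sigma\setminus\{e\}\vdash P$; $\Sigma_1\cup\Sigma_2\vdash P_1\parallel P_2$ if $\Sigma_1\cap\Sigma_2=\emptyset$ and $\Sigma_i\vdash P_i$. Typing is unique; $\Sigma_P$ denotes it. Configurations. $\langle\rho,P\rangle$ with $P$ closed and $\rho$ a density operator on $\mathcal H_{\Sigma_\rho}$; $(\Sigma_\rho,\Sigma_P)\vdash\langle\rho,P\rangle$ if $\Sigma_P\subseteq\Sigma_\rho$; $(\Sigma,\Sigma')\vdash\Delta$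 if every configuration in the support of $\Delta$ is so typed. Semantics. Schedulers $s::=h\mid t\mid(t,t')$; actions $\tau,c!v,c?v$. The relation $\langle\rho,P\rangle\xrightarrow{\mu}_s\Delta$ is the least one with: $\langle\rho,t:\tau.P\rangle\xrightarrow{\tau}_t\overline{\langle\rho,P\rangle}$; $\langle\rho,(t,t'):\tau.P\rangle\xrightarrow{\tau}_{(t,t')}\overline{\langle\rho,P\rangle}$; $\langle\rho,t:c!e.P\rangle\xrightarrow{c!v}_t\overline{\langle\rho,P\rangle}$ if $e\Downarrow v$; $\langle\rho,t:c?x.P\rangle\xrightarrow{c?v}_t\overline{\langle\rho,P[v/x]\rangle}$ (with $v\in\Sigma_\rho$ if $c:\widehat{\mathcal Q}$); $\langle\rho,t:\mathcal E(\tilde q).P\rangle\xrightarrow{\tau}_t\overline{\langle\mathcal E^{\tilde q}(\rho),P\rangle}$; $\langle\rho,t:\mathbb M(\tilde q\rhd y).P\rangle\xrightarrow{\tau}_t\sum_mp_m\bullet\overline{\langle\mathcal M_m^{\tilde q}(\rho)/p_m,P[m/y]\rangle}$, $p_m=\mathrm{tr}(\mathcal M^{\tilde q}_m(\rho))$; if-then-else behaves as the branch selected by $e\Downarrow\mathit{tt}/\mathit{ff}$; $P+Q$ has the transitions of $P$ and of $Q$; restriction: $\langle\rho,P\setminus c\rangle\xrightarrow{\mu}_s\Delta\setminus c$ if $\langle\rho,P\rangle\xrightarrow{\mu}_s\Delta$, $\mu\notin\{c!v,c?v\}$; parallel: $\langle\rho,P\parallel Q\rangle\xrightarrow{\mu}_s\Delta\parallel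 Q$ if $\langle\rho,P\rangle\xrightarrow{\mu}_s\Delta$ and $\mu$ is not $c?v$ with $v\in\Sigma_Q$ (and symmetrically); synchronization: if $\langle\rho,P\rangle\xrightarrow{c!v}_t\overline{\langle\rho,P'\rangle}$ and $\langle\rho,Q\rangle\xrightarrow{c?v}_{t'}\overline{\langle\rho,Q'\rangle}$ then $\langle\rho,P\parallel Q\rangle\xrightarrow{\tau}_{(t,t')}\overline{\langle\rho,P'\parallel Q'\rangle}$ and $\langle\rho,Q\parallel P\rangle\xrightarrow{\tau}_{(t,t')}\overline{\langle\rho,Q'\parallel P'\rangle}$. $\Delta\parallel Q$, $\Delta\setminus c$ are pointwise.
   Formalization: Quantum input also requires that v is not in the receiver's own context Σ_{t:c?x.P}; with only v∈Σ_ρ the claim fails (c?x.(0_q ∥ 0_x) receiving q). Typing also requires variables bound by an input or a measurement to be outside the context. *)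

theory Defs
  imports
    "HOL-Probability.Probability_Mass_Function"
    "Jordan_Normal_Form.Schur_Decomposition"
begin

type_synonym qubit = nat

definition mat_trace :: "complex mat \<Rightarrow> complex" where
  "mat_trace A = (\<Sum>i<dim_row A. A $$ (i, i))"

definition mat_sum :: "nat \<Rightarrow> complex mat list \<Rightarrow> complex mat" where
  "mat_sum d As = foldr (+) As (0\<^sub>m d d)"

text \<open>
  An operator on \<open>H_S\<close>, for a finite set \<open>S\<close> of qubit names, is a square matrix of dimension
  \<open>2 ^ card S\<close>; the tensor factors are ordered by increasing qubit name, the smallest name being
  the leftmost factor, that is, the most significant bit of a basis index.
\<close>

definition density_operator :: "qubit set \<Rightarrow> complex mat \<Rightarrow> bool" where
  "density_operator S \<rho> \<longleftrightarrow>
     finite S \<and>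
     \<rho> \<in> carrier_mat (2 ^ card S) (2 ^ card S) \<and>
     mat_adjoint \<rho> = \<rho> \<and>
     (\<forall>v \<in> carrier_vec (2 ^ card S). 0 \<le> Re ((\<rho> *\<^sub>v v) \<bullet>c v)) \<and>
     mat_trace \<rho> = 1"

definition qubit_bit :: "qubit set \<Rightarrow> nat \<Rightarrow> qubit \<Rightarrow> bool" where
  "qubit_bit S i q = bit i (card {r \<in> S. q < r})"

text \<open>The basis index of \<open>(C^2)^{\<otimes> length qs}\<close> read off at the positions \<open>qs\<close>
  (the head of the list is the most significant bit).\<close>

definition sub_index :: "qubit set \<Rightarrow> qubit list \<Rightarrow> nat \<Rightarrow> nat" where
  "sub_index S qs i = horner_sum of_bool 2 (rev (map (qubit_bit S i) qs))"

text \<open>\<open>lift_op S qs A\<close> acts as \<open>A\<close> on the qubits \<open>qs\<close>, in this order, and as the identity on the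
  remaining qubits of \<open>S\<close>.\<close>

definition lift_op :: "qubit set \<Rightarrow> qubit list \<Rightarrow> complex mat \<Rightarrow> complex mat" where
  "lift_op S qs A = mat (2 ^ card S) (2 ^ card S) (\<lambda>(i, j).
     if \<forall>q \<in> S - set qs. qubit_bit S i q = qubit_bit S j q
     then A $$ (sub_index S qs i, sub_index S qs j) else 0)"

definition complete_family :: "nat \<Rightarrow> complex mat list \<Rightarrow> bool" where
  "complete_family n As \<longleftrightarrow>
     set As \<subseteq> carrier_mat (2 ^ n) (2 ^ n) \<and>
     mat_sum (2 ^ n) (map (\<lambda>A. mat_adjoint A * A) As) = 1\<^sub>m (2 ^ n)"

lemma complete_family_ex: "\<exists>p. complete_family (fst p) (snd p)"
proof -
  have "conjugate (unit_vec 1 0 :: complex vec) = unit_vec 1 0"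
    by (intro eq_vecI) auto
  then have "mat_adjoint (1\<^sub>m 1 :: complex mat) = 1\<^sub>m 1"
    by (intro eq_matI) (auto simp: mat_adjoint_def cols_def mat_of_rows_def)
  then have "complete_family 0 [1\<^sub>m 1]"
    by (simp add: complete_family_def mat_sum_def)
  then show ?thesis by force
qed

text \<open>A trace-preserving superoperator is given by its arity and a family of Kraus operators,
  a measurement by its arity and the operators \<open>M_0, ..., M_{k-1}\<close>.\<close>

typedef superop = "{p. complete_family (fst p) (snd p)}"
  using complete_family_ex by blast

typedef measurement = "{p. complete_family (fst p) (snd p)}"
  using complete_family_ex by blast

definition superop_arity :: "superop \<Rightarrow> nat" where
  "superop_arity E = fst (Rep_superop E)"

definition kraus :: "superop \<Rightarrow> complex mat list" where
  "kraus E = snd (Rep_superop E)"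

definition meas_arity :: "measurement \<Rightarrow> nat" where
  "meas_arity M = fst (Rep_measurement M)"

definition meas_ops :: "measurement \<Rightarrow> complex mat list" where
  "meas_ops M = snd (Rep_measurement M)"

definition conj_by :: "complex mat \<Rightarrow> complex mat \<Rightarrow> complex mat" where
  "conj_by A \<rho> = A * \<rho> * mat_adjoint A"

definition apply_superop :: "superop \<Rightarrow> qubit set \<Rightarrow> qubit list \<Rightarrow> complex mat \<Rightarrow> complex mat" where
  "apply_superop E S qs \<rho> =
     mat_sum (2 ^ card S) (map (\<lambda>A. conj_by (lift_op S qs A) \<rho>) (kraus E))"

definition apply_outcome :: "measurement \<Rightarrow> nat \<Rightarrow> qubit set \<Rightarrow> qubit list \<Rightarrow> complex mat \<Rightarrow> complex mat" where
  "apply_outcome M m S qs \<rho> = conj_by (lift_op S qs (meas_ops M ! m)) \<rho>"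

definition outcome_prob :: "measurement \<Rightarrow> nat \<Rightarrow> qubit set \<Rightarrow> qubit list \<Rightarrow> complex mat \<Rightarrow> real" where
  "outcome_prob M m S qs \<rho> = Re (mat_trace (apply_outcome M m S qs \<rho>))"

type_synonym tag = nat
type_synonym var = nat

datatype ctype = TNat | TBool | TQubit

text \<open>Every channel carries its type; there are denumerably many channels of each type.\<close>

datatype chan = Chan (chan_name: nat) (chan_type: ctype)

datatype val = VNat nat | VBool bool | VQubit qubit

datatype expr =
    EVar var
  | EVal val
  | ENot expr
  | EOr expr expr
  | ELe expr expr
  | EEq expr expr

abbreviation EQubit :: "qubit \<Rightarrow> expr" where
  "EQubit q \<equiv> EVal (VQubit q)"

datatype proc =
    TauP tag proc
  | TauPairP tag tag proc
  | OpP tag superop "expr list" proc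
  | MeasP tag measurement "expr list" var proc
  | RecvP tag chan var proc
  | NilP "expr list"
  | SendP tag chan expr proc
  | IfP expr proc proc
  | SumP proc proc
  | ParP proc proc
  | ResP proc chan

fun fv_expr :: "expr \<Rightarrow> var set" where
  "fv_expr (EVar x) = {x}"
| "fv_expr (EVal v) = {}"
| "fv_expr (ENot e) = fv_expr e"
| "fv_expr (EOr e f) = fv_expr e \<union> fv_expr f"
| "fv_expr (ELe e f) = fv_expr e \<union> fv_expr f"
| "fv_expr (EEq e f) = fv_expr e \<union> fv_expr f"

fun fv :: "proc \<Rightarrow> var set" where
  "fv (TauP t P) = fv P"
| "fv (TauPairP t t' P) = fv P"
| "fv (OpP t E es P) = (\<Union>e \<in> set es. fv_expr e) \<union> fv P"
| "fv (MeasP t M es y P) = (\<Union>e \<in> set es. fv_expr e) \<union> (fv P - {y})"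
| "fv (RecvP t c x P) = fv P - {x}"
| "fv (NilP es) = (\<Union>e \<in> set es. fv_expr e)"
| "fv (SendP t c e P) = fv_expr e \<union> fv P"
| "fv (IfP e P Q) = fv_expr e \<union> fv P \<union> fv Q"
| "fv (SumP P Q) = fv P \<union> fv Q"
| "fv (ParP P Q) = fv P \<union> fv Q"
| "fv (ResP P c) = fv P"

definition closed_proc :: "proc \<Rightarrow> bool" where
  "closed_proc P \<longleftrightarrow> fv P = {}"

fun subst_expr :: "expr \<Rightarrow> val \<Rightarrow> var \<Rightarrow> expr" where
  "subst_expr (EVar y) v x = (if y = x then EVal v else EVar y)"
| "subst_expr (EVal w) v x = EVal w"
| "subst_expr (ENot e) v x = ENot (subst_expr e v x)"
| "subst_expr (EOr e f) v x = EOr (subst_expr e v x) (subst_expr f v x)"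
| "subst_expr (ELe e f) v x = ELe (subst_expr e v x) (subst_expr f v x)"
| "subst_expr (EEq e f) v x = EEq (subst_expr e v x) (subst_expr f v x)"

text \<open>\<open>subst P v x\<close> is \<open>P[v/x]\<close>; only values are substituted, so no capture can occur.\<close>

fun subst :: "proc \<Rightarrow> val \<Rightarrow> var \<Rightarrow> proc" where
  "subst (TauP t P) v x = TauP t (subst P v x)"
| "subst (TauPairP t t' P) v x = TauPairP t t' (subst P v x)"
| "subst (OpP t E es P) v x = OpP t E (map (\<lambda>e. subst_expr e v x) es) (subst P v x)"
| "subst (MeasP t M es y P) v x =
     MeasP t M (map (\<lambda>e. subst_expr e v x) es) y (if y = x then P else subst P v x)"
| "subst (RecvP t c y P) v x = RecvP t c y (if y = x then P else subst P v x)"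
| "subst (NilP es) v x = NilP (map (\<lambda>e. subst_expr e v x) es)"
| "subst (SendP t c e P) v x = SendP t c (subst_expr e v x) (subst P v x)"
| "subst (IfP e P Q) v x = IfP (subst_expr e v x) (subst P v x) (subst Q v x)"
| "subst (SumP P Q) v x = SumP (subst P v x) (subst Q v x)"
| "subst (ParP P Q) v x = ParP (subst P v x) (subst Q v x)"
| "subst (ResP P c) v x = ResP (subst P v x) c"

text \<open>Evaluation is partial: ill-sorted expressions have no value.\<close>

inductive eval_expr :: "expr \<Rightarrow> val \<Rightarrow> bool" (infix "\<Down>" 50) where
  "EVal v \<Down> v"
| "e \<Down> VBool b \<Longrightarrow> ENot e \<Down> VBool (\<not> b)"
| "e \<Down> VBool a \<Longrightarrow> f \<Down> VBool b \<Longrightarrow> EOr e f \<Down> VBool (a \<or> b)"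
| "e \<Down> VNat m \<Longrightarrow> f \<Down> VNat n \<Longrightarrow> ELe e f \<Down> VBool (m \<le> n)"
| "e \<Down> v \<Longrightarrow> f \<Down> w \<Longrightarrow> EEq e f \<Down> VBool (v = w)"

text \<open>
  Under binders for quantum values a context contains variables besides qubit names, and
  processes refer to its elements by expressions; contexts are therefore sets of expressions, and
  the rule for \<open>NilP\<close> admits only qubit names and variables. The premises \<open>EVar x \<notin> \<Gamma>\<close> are the
  usual convention that a bound variable is distinct from all names in the context; without them
  typing would be neither unique nor invariant under renaming of bound variables.
\<close>

definition quantum_names :: "expr set" where
  "quantum_names = range EQubit \<union> range EVar"

definition enumerates :: "expr list \<Rightarrow> expr set \<Rightarrow> bool" where
  "enumerates es E \<longleftrightarrow> distinct es \<and> set es = E"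

inductive typed :: "expr set \<Rightarrow> proc \<Rightarrow> bool" (infix "\<turnstile>" 50) where
  ty_nil: "\<Gamma> \<subseteq> quantum_names \<Longrightarrow> enumerates es \<Gamma> \<Longrightarrow> \<Gamma> \<turnstile> NilP es"
| ty_tau: "\<Gamma> \<turnstile> P \<Longrightarrow> \<Gamma> \<turnstile> TauP t P"
| ty_tau_pair: "\<Gamma> \<turnstile> P \<Longrightarrow> \<Gamma> \<turnstile> TauPairP t t' P"
| ty_op: "enumerates es E \<Longrightarrow> E \<subseteq> \<Gamma> \<Longrightarrow> card E = superop_arity \<E> \<Longrightarrow> \<Gamma> \<turnstile> P
    \<Longrightarrow> \<Gamma> \<turnstile> OpP t \<E> es P"
| ty_meas: "enumerates es E \<Longrightarrow> E \<subseteq> \<Gamma> \<Longrightarrow> card E = meas_arity M \<Longrightarrow> EVar y \<notin> \<Gamma> \<Longrightarrow> \<Gamma> \<turnstile> P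
    \<Longrightarrow> \<Gamma> \<turnstile> MeasP t M es y P"
| ty_crecv: "chan_type c \<noteq> TQubit \<Longrightarrow> EVar x \<notin> \<Gamma> \<Longrightarrow> \<Gamma> \<turnstile> P \<Longrightarrow> \<Gamma> \<turnstile> RecvP t c x P"
| ty_qrecv: "chan_type c = TQubit \<Longrightarrow> EVar x \<notin> \<Gamma> \<Longrightarrow> \<Gamma> \<union> {EVar x} \<turnstile> P \<Longrightarrow> \<Gamma> \<turnstile> RecvP t c x P"
| ty_csend: "chan_type c \<noteq> TQubit \<Longrightarrow> \<Gamma> \<turnstile> P \<Longrightarrow> \<Gamma> \<turnstile> SendP t c e P"
| ty_qsend: "chan_type c = TQubit \<Longrightarrow> e \<in> \<Gamma> \<Longrightarrow> e \<in> quantum_names \<Longrightarrow> \<Gamma> - {e} \<turnstile> P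
    \<Longrightarrow> \<Gamma> \<turnstile> SendP t c e P"
| ty_if: "\<Gamma> \<turnstile> P \<Longrightarrow> \<Gamma> \<turnstile> Q \<Longrightarrow> \<Gamma> \<turnstile> IfP e P Q"
| ty_sum: "\<Gamma> \<turnstile> P \<Longrightarrow> \<Gamma> \<turnstile> Q \<Longrightarrow> \<Gamma> \<turnstile> SumP P Q"
| ty_par: "\<Gamma>\<^sub>1 \<turnstile> P\<^sub>1 \<Longrightarrow> \<Gamma>\<^sub>2 \<turnstile> P\<^sub>2 \<Longrightarrow> \<Gamma>\<^sub>1 \<inter> \<Gamma>\<^sub>2 = {} \<Longrightarrow> \<Gamma>\<^sub>1 \<union> \<Gamma>\<^sub>2 \<turnstile> ParP P\<^sub>1 P\<^sub>2"
| ty_res: "\<Gamma> \<turnstile> P \<Longrightarrow> \<Gamma> \<turnstile> ResP P c"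

inductive_cases typed_NilE: "\<Gamma> \<turnstile> NilP es"
inductive_cases typed_TauE: "\<Gamma> \<turnstile> TauP t P"
inductive_cases typed_TauPairE: "\<Gamma> \<turnstile> TauPairP t t' P"
inductive_cases typed_OpE: "\<Gamma> \<turnstile> OpP t \<E> es P"
inductive_cases typed_MeasE: "\<Gamma> \<turnstile> MeasP t M es y P"
inductive_cases typed_RecvE: "\<Gamma> \<turnstile> RecvP t c x P"
inductive_cases typed_SendE: "\<Gamma> \<turnstile> SendP t c e P"
inductive_cases typed_IfE: "\<Gamma> \<turnstile> IfP e P Q"
inductive_cases typed_SumE: "\<Gamma> \<turnstile> SumP P Q"
inductive_cases typed_ParE: "\<Gamma> \<turnstile> ParP P Q"
inductive_cases typed_ResE: "\<Gamma> \<turnstile> ResP P c"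

lemma typed_unique: "\<Gamma> \<turnstile> P \<Longrightarrow> \<Delta> \<turnstile> P \<Longrightarrow> \<Gamma> = \<Delta>"
proof (induction arbitrary: \<Delta> rule: typed.induct)
  case (ty_nil \<Gamma> es)
  then show ?case by (auto elim!: typed_NilE simp: enumerates_def)
next
  case (ty_qrecv c x \<Gamma> P t)
  from ty_qrecv.prems ty_qrecv.hyps(1)
  have "EVar x \<notin> \<Delta>" "\<Delta> \<union> {EVar x} \<turnstile> P" by (auto elim: typed_RecvE)
  then show ?case using ty_qrecv.IH ty_qrecv.hyps(2) by blast
next
  case (ty_qsend c e \<Gamma> P t)
  from ty_qsend.prems ty_qsend.hyps(1)
  have "e \<in> \<Delta>" "\<Delta> - {e} \<turnstile> P" by (auto elim: typed_SendE)
  then show ?case using ty_qsend.IH ty_qsend.hyps(2) by blast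
next
  case (ty_par \<Gamma>\<^sub>1 P\<^sub>1 \<Gamma>\<^sub>2 P\<^sub>2)
  from ty_par.prems show ?case by (rule typed_ParE) (use ty_par.IH in blast)
next
  case (ty_crecv c x \<Gamma> P t)
  from ty_crecv.prems ty_crecv.hyps(1) have "\<Delta> \<turnstile> P" by (auto elim: typed_RecvE)
  then show ?case using ty_crecv.IH by blast
next
  case (ty_csend c \<Gamma> P t e)
  from ty_csend.prems ty_csend.hyps(1) have "\<Delta> \<turnstile> P" by (auto elim: typed_SendE)
  then show ?case using ty_csend.IH by blast
qed (blast elim: typed_TauE typed_TauPairE typed_OpE typed_MeasE typed_IfE typed_SumE typed_ResE)+

definition ctx :: "proc \<Rightarrow> expr set" where
  "ctx P = (THE \<Gamma>. \<Gamma> \<turnstile> P)"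

lemma ctx_eq: "\<Gamma> \<turnstile> P \<Longrightarrow> ctx P = \<Gamma>"
  unfolding ctx_def by (rule the_equality) (simp_all add: typed_unique)

text \<open>\<open>Conf S \<rho> P\<close> is the configuration \<open>\<langle>\<rho>, P\<rangle>\<close> with \<open>\<Sigma>_\<rho> = S\<close>.\<close>

datatype conf = Conf (qubits: "qubit set") (state: "complex mat") (process: proc)

definition Configs :: "conf set" where
  "Configs = {C. density_operator (qubits C) (state C) \<and> closed_proc (process C)}"

definition fin_dists :: "'a set \<Rightarrow> 'a pmf set" where
  "fin_dists A = {\<Delta>. finite (set_pmf \<Delta>) \<and> set_pmf \<Delta> \<subseteq> A}"

text \<open>\<open>is_convex_comb k p D \<Delta>\<close> says that \<open>\<Delta>\<close> is the combination of \<open>D 0, ..., D (k - 1)\<close> with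
  weights \<open>p 0, ..., p (k - 1)\<close>.\<close>

definition is_convex_comb :: "nat \<Rightarrow> (nat \<Rightarrow> real) \<Rightarrow> (nat \<Rightarrow> 'a pmf) \<Rightarrow> 'a pmf \<Rightarrow> bool" where
  "is_convex_comb k p D \<Delta> \<longleftrightarrow>
     (\<forall>i<k. 0 \<le> p i) \<and> (\<Sum>i<k. p i) = 1 \<and> (\<forall>x. pmf \<Delta> x = (\<Sum>i<k. p i * pmf (D i) x))"

definition conf_typed :: "qubit set \<Rightarrow> qubit set \<Rightarrow> conf \<Rightarrow> bool" where
  "conf_typed S S' C \<longleftrightarrow> qubits C = S \<and> EQubit ` S' \<turnstile> process C \<and> S' \<subseteq> S"

definition dist_typed :: "qubit set \<Rightarrow> qubit set \<Rightarrow> conf pmf \<Rightarrow> bool" where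
  "dist_typed S S' \<Delta> \<longleftrightarrow> (\<forall>C \<in> set_pmf \<Delta>. conf_typed S S' C)"

datatype sched = SHalt | STag tag | SPair tag tag

datatype action = Tau | Out chan val | In chan val

definition map_proc :: "(proc \<Rightarrow> proc) \<Rightarrow> conf pmf \<Rightarrow> conf pmf" where
  "map_proc f = map_pmf (\<lambda>C. Conf (qubits C) (state C) (f (process C)))"

definition input_disjoint :: "action \<Rightarrow> proc \<Rightarrow> bool" where
  "input_disjoint \<mu> Q \<longleftrightarrow> (\<forall>c v. \<mu> = In c v \<longrightarrow> EVal v \<notin> ctx Q)"

text \<open>
  A qubit can be received only if the receiver does not own it already: \<open>q \<notin> \<Sigma>_P\<close> for the
  receiving process \<open>P\<close>, as in the quantum input rule of qCCS. This complements the condition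
  \<open>input_disjoint\<close> on parallel components; the lemma \<open>recv_owned_untypable\<close> below shows that types are
  not preserved otherwise.
\<close>

definition receivable :: "qubit set \<Rightarrow> chan \<Rightarrow> val \<Rightarrow> proc \<Rightarrow> bool" where
  "receivable S c v P \<longleftrightarrow>
     (chan_type c = TQubit \<longrightarrow> (\<exists>q. v = VQubit q \<and> q \<in> S \<and> EQubit q \<notin> ctx P))"

inductive step :: "conf \<Rightarrow> action \<Rightarrow> sched \<Rightarrow> conf pmf \<Rightarrow> bool" where
  st_tau: "step (Conf S \<rho> (TauP t P)) Tau (STag t) (return_pmf (Conf S \<rho> P))"
| st_tau_pair: "step (Conf S \<rho> (TauPairP t t' P)) Tau (SPair t t') (return_pmf (Conf S \<rho> P))"
| st_send: "e \<Down> v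
    \<Longrightarrow> step (Conf S \<rho> (SendP t c e P)) (Out c v) (STag t) (return_pmf (Conf S \<rho> P))"
| st_recv: "receivable S c v (RecvP t c x P)
    \<Longrightarrow> step (Conf S \<rho> (RecvP t c x P)) (In c v) (STag t) (return_pmf (Conf S \<rho> (subst P v x)))"
| st_op: "step (Conf S \<rho> (OpP t \<E> (map EQubit qs) P)) Tau (STag t)
    (return_pmf (Conf S (apply_superop \<E> S qs \<rho>) P))"
| st_meas: "is_convex_comb (length (meas_ops M)) (\<lambda>m. outcome_prob M m S qs \<rho>)
      (\<lambda>m. return_pmf (Conf S
        (complex_of_real (1 / outcome_prob M m S qs \<rho>) \<cdot>\<^sub>m apply_outcome M m S qs \<rho>)
        (subst P (VNat m) y))) \<Delta>
    \<Longrightarrow> step (Conf S \<rho> (MeasP t M (map EQubit qs) y P)) Tau (STag t) \<Delta>"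
| st_if_true: "e \<Down> VBool True \<Longrightarrow> step (Conf S \<rho> P) \<mu> s \<Delta> \<Longrightarrow> step (Conf S \<rho> (IfP e P Q)) \<mu> s \<Delta>"
| st_if_false: "e \<Down> VBool False \<Longrightarrow> step (Conf S \<rho> Q) \<mu> s \<Delta> \<Longrightarrow> step (Conf S \<rho> (IfP e P Q)) \<mu> s \<Delta>"
| st_sum_left: "step (Conf S \<rho> P) \<mu> s \<Delta> \<Longrightarrow> step (Conf S \<rho> (SumP P Q)) \<mu> s \<Delta>"
| st_sum_right: "step (Conf S \<rho> Q) \<mu> s \<Delta> \<Longrightarrow> step (Conf S \<rho> (SumP P Q)) \<mu> s \<Delta>"
| st_res: "step (Conf S \<rho> P) \<mu> s \<Delta> \<Longrightarrow> \<forall>v. \<mu> \<noteq> Out c v \<and> \<mu> \<noteq> In c v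
    \<Longrightarrow> step (Conf S \<rho> (ResP P c)) \<mu> s (map_proc (\<lambda>R. ResP R c) \<Delta>)"
| st_par_left: "step (Conf S \<rho> P) \<mu> s \<Delta> \<Longrightarrow> input_disjoint \<mu> Q
    \<Longrightarrow> step (Conf S \<rho> (ParP P Q)) \<mu> s (map_proc (\<lambda>R. ParP R Q) \<Delta>)"
| st_par_right: "step (Conf S \<rho> Q) \<mu> s \<Delta> \<Longrightarrow> input_disjoint \<mu> P
    \<Longrightarrow> step (Conf S \<rho> (ParP P Q)) \<mu> s (map_proc (\<lambda>R. ParP P R) \<Delta>)"
| st_sync_left: "step (Conf S \<rho> P) (Out c v) (STag t) (return_pmf (Conf S \<rho> P'))
    \<Longrightarrow> step (Conf S \<rho> Q) (In c v) (STag t') (return_pmf (Conf S \<rho> Q'))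
    \<Longrightarrow> step (Conf S \<rho> (ParP P Q)) Tau (SPair t t') (return_pmf (Conf S \<rho> (ParP P' Q')))"
| st_sync_right: "step (Conf S \<rho> P) (Out c v) (STag t) (return_pmf (Conf S \<rho> P'))
    \<Longrightarrow> step (Conf S \<rho> Q) (In c v) (STag t') (return_pmf (Conf S \<rho> Q'))
    \<Longrightarrow> step (Conf S \<rho> (ParP Q P)) Tau (SPair t t') (return_pmf (Conf S \<rho> (ParP Q' P')))"

lemma recv_owned_untypable:
  assumes "chan_type c = TQubit"
  shows "{EQubit q} \<turnstile> RecvP t c x (NilP [EQubit q, EVar x])"
    and "\<not> \<Gamma> \<turnstile> subst (NilP [EQubit q, EVar x]) (VQubit q) x"
proof -
  show "{EQubit q} \<turnstile> RecvP t c x (NilP [EQubit q, EVar x])"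
    using assms by (auto intro!: ty_qrecv ty_nil simp: enumerates_def quantum_names_def)
  show "\<not> \<Gamma> \<turnstile> subst (NilP [EQubit q, EVar x]) (VQubit q) x"
    by (auto elim: typed_NilE simp: enumerates_def)
qed

end

theory Submission
  imports Defs
begin

text \<open>
  A transition changes the context only by the qubit it sends or receives. An output removes a
  qubit that the sender owns; an input adds a qubit that neither the receiver nor any parallel
  component owns; in a synchronization the two effects cancel. The input case rests on a
  substitution lemma: a substitution that is injective on the context preserves linearity.
\<close>

section \<open>Substitution and linear contexts\<close>

lemma typed_quantum_names: "\<Gamma> \<turnstile> P \<Longrightarrow> \<Gamma> \<subseteq> quantum_names"
  by (induction rule: typed.induct) auto

text \<open>On a context of quantum names, this says that replacing \<open>x\<close> by
  \<open>v\<close> neither identifies two names nor leaves the quantum names. It is vacuous when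
  \<open>x\<close> is not in the context; then \<open>v\<close> may be classical.\<close>

definition subst_fresh :: "expr set \<Rightarrow> val \<Rightarrow> var \<Rightarrow> bool" where
  "subst_fresh \<Gamma> v x \<longleftrightarrow> (EVar x \<in> \<Gamma> \<longrightarrow> (\<exists>q. v = VQubit q \<and> EQubit q \<notin> \<Gamma>))"

lemma subst_fresh_mono: "subst_fresh \<Gamma> v x \<Longrightarrow> \<Gamma>' \<subseteq> \<Gamma> \<Longrightarrow> subst_fresh \<Gamma>' v x"
  by (auto simp: subst_fresh_def)

lemma subst_expr_id: "e \<in> quantum_names \<Longrightarrow> e \<noteq> EVar x \<Longrightarrow> subst_expr e v x = e"
  by (auto simp: quantum_names_def split: if_splits)

lemma subst_context_id:
  assumes "\<Gamma> \<subseteq> quantum_names" "EVar x \<notin> \<Gamma>"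
  shows "(\<lambda>e. subst_expr e v x) ` \<Gamma> = \<Gamma>"
proof -
  have "subst_expr e v x = e" if "e \<in> \<Gamma>" for e
    using assms that by (intro subst_expr_id) auto
  then show ?thesis by (simp cong: image_cong)
qed

lemma subst_context_inj:
  assumes "\<Gamma> \<subseteq> quantum_names" "subst_fresh \<Gamma> v x"
  shows "inj_on (\<lambda>e. subst_expr e v x) \<Gamma>"
proof (rule inj_onI)
  fix e f assume ef: "e \<in> \<Gamma>" "f \<in> \<Gamma>" "subst_expr e v x = subst_expr f v x"
  with assms(1) have "e \<in> quantum_names" "f \<in> quantum_names" by auto
  with ef assms(2) show "e = f"
    by (auto simp: quantum_names_def subst_fresh_def split: if_splits)
qed

lemma subst_context_quantum_names:
  assumes "\<Gamma> \<subseteq> quantum_names" "subst_fresh \<Gamma> v x"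
  shows "(\<lambda>e. subst_expr e v x) ` \<Gamma> \<subseteq> quantum_names"
proof (rule image_subsetI)
  fix e assume "e \<in> \<Gamma>"
  moreover from this assms(1) have "e \<in> quantum_names" by auto
  ultimately show "subst_expr e v x \<in> quantum_names"
    using assms(2) by (auto simp: quantum_names_def subst_fresh_def)
qed

text \<open>Values contain no variables, so a substitution creates none; this keeps the side
  conditions of the binding rules.\<close>

lemma subst_context_var:
  assumes "\<Gamma> \<subseteq> quantum_names" "EVar y \<notin> \<Gamma>"
  shows "EVar y \<notin> (\<lambda>e. subst_expr e v x) ` \<Gamma>"
proof
  assume "EVar y \<in> (\<lambda>e. subst_expr e v x) ` \<Gamma>"
  then obtain e where e: "e \<in> \<Gamma>" "subst_expr e v x = EVar y" by auto
  with assms(1) have "e \<in> quantum_names" by auto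
  with e assms(2) show False by (auto simp: quantum_names_def split: if_splits)
qed

lemma enumerates_map:
  "enumerates es E \<Longrightarrow> inj_on f E \<Longrightarrow> enumerates (map f es) (f ` E)"
  by (auto simp: enumerates_def distinct_map)

text \<open>Injectivity on the context preserves distinctness and cardinality of name lists, set
  difference and disjointness, hence the linear side conditions of the typing rules.\<close>

lemma typed_subst:
  assumes "\<Gamma> \<turnstile> P" "subst_fresh \<Gamma> v x"
  shows "(\<lambda>e. subst_expr e v x) ` \<Gamma> \<turnstile> subst P v x"
  using assms
proof (induction rule: typed.induct)
  case (ty_nil \<Gamma> es)
  then show ?case
    by (simp add: typed.ty_nil enumerates_map subst_context_inj subst_context_quantum_names)
next
  case (ty_op es E \<Gamma> \<E> P t)
  have "inj_on (\<lambda>e. subst_expr e v x) E"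
    using subst_context_inj[OF typed_quantum_names[OF ty_op.hyps(4)] ty_op.prems] ty_op.hyps(2)
    by (rule inj_on_subset)
  with ty_op show ?case
    by (auto intro!: typed.ty_op enumerates_map simp: card_image)
next
  case (ty_meas es E \<Gamma> M y P t)
  note names = typed_quantum_names[OF ty_meas.hyps(5)]
  have "inj_on (\<lambda>e. subst_expr e v x) E"
    using subst_context_inj[OF names ty_meas.prems] ty_meas.hyps(2) by (rule inj_on_subset)
  \<comment> \<open>If \<open>y = x\<close>, the substitution stops at the binder; then
    \<open>EVar x\<close> is not in \<open>\<Gamma>\<close>, so the image of the context is
    \<open>\<Gamma>\<close> itself.\<close>
  moreover have "(\<lambda>e. subst_expr e v x) ` \<Gamma> \<turnstile> (if y = x then P else subst P v x)"
    using ty_meas.IH[OF ty_meas.prems] ty_meas.hyps(4,5) subst_context_id[OF names, of x v]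
    by (cases "y = x") simp_all
  ultimately show ?case
    using ty_meas subst_context_var[OF names ty_meas.hyps(4)]
    by (auto intro!: typed.ty_meas enumerates_map simp: card_image)
next
  case (ty_crecv c y \<Gamma> P t)
  note names = typed_quantum_names[OF ty_crecv.hyps(3)]
  have "(\<lambda>e. subst_expr e v x) ` \<Gamma> \<turnstile> (if y = x then P else subst P v x)"
    using ty_crecv.IH[OF ty_crecv.prems] ty_crecv.hyps(2,3) subst_context_id[OF names, of x v]
    by (cases "y = x") simp_all
  then show ?case
    using ty_crecv subst_context_var[OF names ty_crecv.hyps(2)] by (simp add: typed.ty_crecv)
next
  case (ty_qrecv c y \<Gamma> P t)
  have names: "\<Gamma> \<subseteq> quantum_names"
    using typed_quantum_names[OF ty_qrecv.hyps(3)] by simp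
  have "(\<lambda>e. subst_expr e v x) ` \<Gamma> \<union> {EVar y} \<turnstile> (if y = x then P else subst P v x)"
  proof (cases "y = x")
    case True
    then show ?thesis using ty_qrecv.hyps(2,3) subst_context_id[OF names, of x v] by simp
  next
    case False
    \<comment> \<open>The added name is neither \<open>EVar x\<close> nor a qubit name, so freshness
      survives.\<close>
    then have "subst_fresh (\<Gamma> \<union> {EVar y}) v x"
      using ty_qrecv.prems by (auto simp: subst_fresh_def)
    with ty_qrecv.IH False show ?thesis by simp
  qed
  then show ?case
    using ty_qrecv.hyps(1) subst_context_var[OF names ty_qrecv.hyps(2)]
    by (simp add: typed.ty_qrecv)
next
  case (ty_qsend c e \<Gamma> P t)
  have names: "\<Gamma> \<subseteq> quantum_names"
    using typed_quantum_names[OF ty_qsend.hyps(4)] ty_qsend.hyps(3) by auto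
  \<comment> \<open>Without injectivity, another name could collide with the image of
    \<open>e\<close> and be lost from the difference.\<close>
  have "(\<lambda>e. subst_expr e v x) ` (\<Gamma> - {e}) =
      (\<lambda>e. subst_expr e v x) ` \<Gamma> - {subst_expr e v x}"
    using inj_on_image_set_diff[OF subst_context_inj[OF names ty_qsend.prems], of \<Gamma> "{e}"]
      ty_qsend.hyps(2) by simp
  moreover have "subst_fresh (\<Gamma> - {e}) v x"
    using ty_qsend.prems by (rule subst_fresh_mono) auto
  moreover have "subst_expr e v x \<in> quantum_names"
    using subst_context_quantum_names[OF names ty_qsend.prems] ty_qsend.hyps(2) by auto
  ultimately show ?case
    using ty_qsend by (auto intro!: typed.ty_qsend)
next
  case (ty_par \<Gamma>\<^sub>1 P\<^sub>1 \<Gamma>\<^sub>2 P\<^sub>2)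
  have names: "\<Gamma>\<^sub>1 \<union> \<Gamma>\<^sub>2 \<subseteq> quantum_names"
    using typed_quantum_names ty_par.hyps by blast
  \<comment> \<open>Freshness is used for the union: it excludes that \<open>x\<close> lies in one
    context and the substituted qubit in the other.\<close>
  have "(\<lambda>e. subst_expr e v x) ` \<Gamma>\<^sub>1 \<inter> (\<lambda>e. subst_expr e v x) ` \<Gamma>\<^sub>2 = {}"
    using inj_on_image_Int[OF subst_context_inj[OF names ty_par.prems], of \<Gamma>\<^sub>1 \<Gamma>\<^sub>2] ty_par.hyps(3)
    by simp
  moreover have "subst_fresh \<Gamma>\<^sub>1 v x" "subst_fresh \<Gamma>\<^sub>2 v x"
    using ty_par.prems by (auto elim: subst_fresh_mono)
  ultimately show ?case
    using typed.ty_par ty_par.IH by (simp add: image_Un)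
qed (simp_all add: typed.intros)

text \<open>Covers binders of classical data: inputs on classical channels and measurement
  outcomes.\<close>

lemma typed_subst_fresh:
  assumes "\<Gamma> \<turnstile> P" "EVar x \<notin> \<Gamma>"
  shows "\<Gamma> \<turnstile> subst P v x"
  using typed_subst[of \<Gamma> P v x] subst_context_id[OF typed_quantum_names] assms
  by (simp add: subst_fresh_def)

lemma typed_subst_qubit:
  assumes "insert (EVar x) \<Gamma> \<turnstile> P" "EVar x \<notin> \<Gamma>" "EQubit q \<notin> \<Gamma>"
  shows "insert (EQubit q) \<Gamma> \<turnstile> subst P (VQubit q) x"
proof -
  have "\<Gamma> \<subseteq> quantum_names" using typed_quantum_names[OF assms(1)] by simp
  from subst_context_id[OF this assms(2), of "VQubit q"]
  have "(\<lambda>e. subst_expr e (VQubit q) x) ` insert (EVar x) \<Gamma> = insert (EQubit q) \<Gamma>" by simp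
  moreover have "subst_fresh (insert (EVar x) \<Gamma>) (VQubit q) x"
    using assms(3) by (simp add: subst_fresh_def)
  ultimately show ?thesis using typed_subst[OF assms(1)] by metis
qed

section \<open>Effect of an action on the context\<close>

text \<open>A function of the action and the old context alone, which makes the final witness
  uniform in configurations, schedulers and distributions.\<close>

fun ctx_after :: "action \<Rightarrow> expr set \<Rightarrow> expr set" where
  "ctx_after Tau \<Gamma> = \<Gamma>"
| "ctx_after (Out c v) \<Gamma> = (if chan_type c = TQubit then \<Gamma> - {EVal v} else \<Gamma>)"
| "ctx_after (In c v) \<Gamma> = (if chan_type c = TQubit then insert (EVal v) \<Gamma> else \<Gamma>)"

inductive_cases eval_EVarE: "EVar x \<Down> v"
inductive_cases eval_EValE: "EVal w \<Down> v"

text \<open>Variables have no value and qubit names evaluate to themselves, so the value sent is the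
  very name that \<open>ty_qsend\<close> removes.\<close>

lemma eval_quantum_name:
  assumes "e \<in> quantum_names" "e \<Down> v"
  shows "e = EVal v"
  using assms by (auto simp: quantum_names_def elim: eval_EVarE eval_EValE)

text \<open>A quantum send owns its name by \<open>ty_qsend\<close>; every other rule with an output
  label keeps or enlarges the context of the emitting component.\<close>

lemma step_out_owned:
  assumes "step C (Out c v) s \<Delta>" "chan_type c = TQubit" "\<Gamma> \<turnstile> process C"
  shows "EVal v \<in> \<Gamma>"
  using assms
proof (induction C "Out c v" s \<Delta> arbitrary: \<Gamma> rule: step.induct)
  case st_send
  then show ?case by (auto elim!: typed_SendE dest: eval_quantum_name)
qed (auto elim!: typed_IfE typed_SumE typed_ResE typed_ParE)

lemma step_in_qubit:
  assumes "step C (In c v) s \<Delta>" "chan_type c = TQubit"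
  shows "\<exists>q \<in> qubits C. v = VQubit q"
  using assms
  by (induction C "In c v" s \<Delta> rule: step.induct) (auto simp: receivable_def)

text \<open>If \<open>x\<close> had mass zero in every component, the weighted sum would vanish at
  \<open>x\<close>.\<close>

lemma convex_comb_support:
  assumes "is_convex_comb k p D \<Delta>" "x \<in> set_pmf \<Delta>"
  shows "\<exists>i<k. x \<in> set_pmf (D i)"
proof (rule ccontr)
  assume "\<not> ?thesis"
  then have "(\<Sum>i<k. p i * pmf (D i) x) = 0"
    by (intro sum.neutral) (auto simp: set_pmf_iff)
  with assms show False by (simp add: is_convex_comb_def set_pmf_iff)
qed

text \<open>A removed qubit lies in \<open>\<Gamma>\<^sub>1\<close>, hence not in
  \<open>\<Gamma>\<^sub>2\<close>; an added one is kept out of \<open>\<Gamma>\<^sub>2\<close> by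
  \<open>input_disjoint\<close>.\<close>

lemma ctx_after_par:
  assumes "\<Gamma>\<^sub>1 \<inter> \<Gamma>\<^sub>2 = {}" "\<Gamma>\<^sub>2 \<turnstile> Q" "input_disjoint \<mu> Q"
    and "\<forall>c v. \<mu> = Out c v \<longrightarrow> chan_type c = TQubit \<longrightarrow> EVal v \<in> \<Gamma>\<^sub>1"
  shows "ctx_after \<mu> \<Gamma>\<^sub>1 \<inter> \<Gamma>\<^sub>2 = {}" "ctx_after \<mu> (\<Gamma>\<^sub>1 \<union> \<Gamma>\<^sub>2) = ctx_after \<mu> \<Gamma>\<^sub>1 \<union> \<Gamma>\<^sub>2"
  using assms by (cases \<mu>; auto simp: input_disjoint_def ctx_eq)+

text \<open>A quantum communication moves one qubit between disjoint contexts, so their disjointness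
  and their union survive.\<close>

lemma ctx_after_sync:
  assumes "\<Gamma>\<^sub>1 \<inter> \<Gamma>\<^sub>2 = {}" "chan_type c = TQubit \<Longrightarrow> EVal v \<in> \<Gamma>\<^sub>1"
  shows "ctx_after (Out c v) \<Gamma>\<^sub>1 \<inter> ctx_after (In c v) \<Gamma>\<^sub>2 = {}"
    "ctx_after (Out c v) \<Gamma>\<^sub>1 \<union> ctx_after (In c v) \<Gamma>\<^sub>2 = \<Gamma>\<^sub>1 \<union> \<Gamma>\<^sub>2"
  using assms by auto

section \<open>Preservation of typing along transitions\<close>

text \<open>The induction on transitions leaves \<open>\<Gamma>\<close> arbitrary, because parallel
  components are typed in parts of the context.\<close>

lemma step_preserves_typing:
  assumes "step C \<mu> s \<Delta>" "\<Gamma> \<turnstile> process C" "C' \<in> set_pmf \<Delta>"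
  shows "qubits C' = qubits C \<and> ctx_after \<mu> \<Gamma> \<turnstile> process C'"
  using assms
proof (induction C \<mu> s \<Delta> arbitrary: \<Gamma> C' rule: step.induct)
  case (st_send e v S \<rho> t c P)
  then show ?case by (auto elim!: typed_SendE dest: eval_quantum_name)
next
  case (st_recv S c v t x P \<rho>)
  from st_recv.prems(1) have ty: "\<Gamma> \<turnstile> RecvP t c x P" by simp
  show ?case
  proof (cases "chan_type c = TQubit")
    case True
    \<comment> \<open>\<open>receivable\<close> refers to \<open>ctx\<close> of the whole input
      prefix, which is \<open>\<Gamma>\<close> by uniqueness of typing.\<close>
    from st_recv.hyps True ctx_eq[OF ty]
    obtain q where "v = VQubit q" "EQubit q \<notin> \<Gamma>" by (auto simp: receivable_def)
    moreover from ty True have "insert (EVar x) \<Gamma> \<turnstile> P" "EVar x \<notin> \<Gamma>"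
      by (auto elim: typed_RecvE)
    ultimately show ?thesis using st_recv.prems True typed_subst_qubit by simp
  next
    case False
    with ty have "\<Gamma> \<turnstile> P" "EVar x \<notin> \<Gamma>" by (auto elim: typed_RecvE)
    with st_recv.prems False typed_subst_fresh show ?thesis by simp
  qed
next
  case (st_meas M S qs \<rho> P y \<Delta> t)
  from st_meas.prems(1) have "\<Gamma> \<turnstile> P" "EVar y \<notin> \<Gamma>" by (auto elim: typed_MeasE)
  \<comment> \<open>Each supported outcome substitutes a number for \<open>y\<close>, which is not
    in \<open>\<Gamma>\<close>.\<close>
  then show ?case
    using convex_comb_support[OF st_meas.hyps st_meas.prems(2)] typed_subst_fresh by auto
next
  case (st_par_left S \<rho> P \<mu> s \<Delta> Q)
  from st_par_left.prems(1) obtain \<Gamma>\<^sub>1 \<Gamma>\<^sub>2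
    where \<Gamma>: "\<Gamma> = \<Gamma>\<^sub>1 \<union> \<Gamma>\<^sub>2" "\<Gamma>\<^sub>1 \<turnstile> P" "\<Gamma>\<^sub>2 \<turnstile> Q" "\<Gamma>\<^sub>1 \<inter> \<Gamma>\<^sub>2 = {}"
    by (auto elim: typed_ParE)
  have "\<forall>c v. \<mu> = Out c v \<longrightarrow> chan_type c = TQubit \<longrightarrow> EVal v \<in> \<Gamma>\<^sub>1"
    using step_out_owned st_par_left.hyps(1) \<Gamma>(2) by fastforce
  note after = ctx_after_par[OF \<Gamma>(4,3) st_par_left.hyps(2) this]
  from st_par_left.prems(2) obtain D where "D \<in> set_pmf \<Delta>"
    "C' = Conf (qubits D) (state D) (ParP (process D) Q)"
    by (auto simp: map_proc_def)
  with st_par_left.IH[of \<Gamma>\<^sub>1 D] \<Gamma> after show ?case by (auto intro: typed.ty_par)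
next
  case (st_par_right S \<rho> Q \<mu> s \<Delta> P)
  \<comment> \<open>Disjointness is stated with \<open>\<Gamma>\<^sub>2\<close> first, so that
    \<open>ctx_after_par\<close> applies with the roles swapped.\<close>
  from st_par_right.prems(1) obtain \<Gamma>\<^sub>1 \<Gamma>\<^sub>2
    where \<Gamma>: "\<Gamma> = \<Gamma>\<^sub>1 \<union> \<Gamma>\<^sub>2" "\<Gamma>\<^sub>1 \<turnstile> P" "\<Gamma>\<^sub>2 \<turnstile> Q" "\<Gamma>\<^sub>2 \<inter> \<Gamma>\<^sub>1 = {}"
    by (auto elim: typed_ParE simp: Int_commute)
  have "\<forall>c v. \<mu> = Out c v \<longrightarrow> chan_type c = TQubit \<longrightarrow> EVal v \<in> \<Gamma>\<^sub>2"
    using step_out_owned st_par_right.hyps(1) \<Gamma>(3) by fastforce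
  note after = ctx_after_par[OF \<Gamma>(4,2) st_par_right.hyps(2) this]
  from after have "ctx_after \<mu> \<Gamma> = \<Gamma>\<^sub>1 \<union> ctx_after \<mu> \<Gamma>\<^sub>2" "\<Gamma>\<^sub>1 \<inter> ctx_after \<mu> \<Gamma>\<^sub>2 = {}"
    using \<Gamma>(1) by (auto simp: Un_commute)
  moreover from st_par_right.prems(2) obtain D where "D \<in> set_pmf \<Delta>"
    "C' = Conf (qubits D) (state D) (ParP P (process D))"
    by (auto simp: map_proc_def)
  ultimately show ?case using st_par_right.IH[of \<Gamma>\<^sub>2 D] \<Gamma> by (auto intro: typed.ty_par)
next
  case (st_sync_left S \<rho> P c v t P' Q t' Q')
  from st_sync_left.prems(1) obtain \<Gamma>\<^sub>1 \<Gamma>\<^sub>2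
    where \<Gamma>: "\<Gamma> = \<Gamma>\<^sub>1 \<union> \<Gamma>\<^sub>2" "\<Gamma>\<^sub>1 \<turnstile> P" "\<Gamma>\<^sub>2 \<turnstile> Q" "\<Gamma>\<^sub>1 \<inter> \<Gamma>\<^sub>2 = {}"
    by (auto elim: typed_ParE)
  have "EVal v \<in> \<Gamma>\<^sub>1" if "chan_type c = TQubit"
    using step_out_owned[OF st_sync_left.hyps(1) that] \<Gamma>(2) by simp
  note after = ctx_after_sync[OF \<Gamma>(4) this]
  have "ctx_after (Out c v) \<Gamma>\<^sub>1 \<turnstile> P'" "ctx_after (In c v) \<Gamma>\<^sub>2 \<turnstile> Q'"
    using st_sync_left.IH(1)[of \<Gamma>\<^sub>1] st_sync_left.IH(2)[of \<Gamma>\<^sub>2] \<Gamma> by simp_all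
  from typed.ty_par[OF this after(1)] show ?case
    using st_sync_left.prems(2) \<Gamma>(1) after(2) by simp
next
  case (st_sync_right S \<rho> P c v t P' Q t' Q')
  \<comment> \<open>The sender is now the right component; its context is still called
    \<open>\<Gamma>\<^sub>1\<close>.\<close>
  from st_sync_right.prems(1) obtain \<Gamma>\<^sub>1 \<Gamma>\<^sub>2
    where \<Gamma>: "\<Gamma> = \<Gamma>\<^sub>2 \<union> \<Gamma>\<^sub>1" "\<Gamma>\<^sub>1 \<turnstile> P" "\<Gamma>\<^sub>2 \<turnstile> Q" "\<Gamma>\<^sub>1 \<inter> \<Gamma>\<^sub>2 = {}"
    by (auto elim: typed_ParE simp: Int_commute)
  have "EVal v \<in> \<Gamma>\<^sub>1" if "chan_type c = TQubit"
    using step_out_owned[OF st_sync_right.hyps(1) that] \<Gamma>(2) by simp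
  note after = ctx_after_sync[OF \<Gamma>(4) this]
  have tys: "ctx_after (In c v) \<Gamma>\<^sub>2 \<turnstile> Q'" "ctx_after (Out c v) \<Gamma>\<^sub>1 \<turnstile> P'"
    using st_sync_right.IH(1)[of \<Gamma>\<^sub>1] st_sync_right.IH(2)[of \<Gamma>\<^sub>2] \<Gamma> by simp_all
  have "ctx_after (In c v) \<Gamma>\<^sub>2 \<inter> ctx_after (Out c v) \<Gamma>\<^sub>1 = {}"
    "ctx_after (In c v) \<Gamma>\<^sub>2 \<union> ctx_after (Out c v) \<Gamma>\<^sub>1 = \<Gamma>"
    using after \<Gamma>(1) by (metis Int_commute, metis Un_commute)
  with typed.ty_par[OF tys] show ?case
    using st_sync_right.prems(2) by simp
next
  case (st_res S \<rho> P \<mu> s \<Delta> c)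
  from st_res.prems obtain D where "D \<in> set_pmf \<Delta>" "\<Gamma> \<turnstile> P"
    "C' = Conf (qubits D) (state D) (ResP (process D) c)"
    by (auto simp: map_proc_def elim: typed_ResE)
  with st_res.IH[of \<Gamma> D] show ?case by (auto intro: typed.ty_res)
qed (auto elim!: typed_TauE typed_TauPairE typed_OpE typed_IfE typed_SumE)

theorem theorem2:
  fixes \<Sigma> :: "qubit set" and \<mu> :: action
  shows "\<exists>\<Sigma>' :: qubit set. \<forall>\<Sigma>'' C s \<Delta>.
    C \<in> Configs \<longrightarrow> conf_typed \<Sigma>'' \<Sigma> C \<longrightarrow> \<Delta> \<in> fin_dists Configs \<longrightarrow> step C \<mu> s \<Delta>
      \<longrightarrow> dist_typed \<Sigma>'' \<Sigma>' \<Delta>"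
proof -
  \<comment> \<open>For an arbitrary action, \<open>ctx_after\<close> may contain a value that is no
    qubit, so only the qubit names are collected.\<close>
  define \<Sigma>' where "\<Sigma>' = {q. EQubit q \<in> ctx_after \<mu> (EQubit ` \<Sigma>)}"
  have "conf_typed \<Sigma>'' \<Sigma>' C'"
    if C: "conf_typed \<Sigma>'' \<Sigma> C" and st: "step C \<mu> s \<Delta>" and C': "C' \<in> set_pmf \<Delta>"
    for \<Sigma>'' C s \<Delta> C'
  proof -
    have ty: "EQubit ` \<Sigma> \<turnstile> process C" and sub: "qubits C = \<Sigma>''" "\<Sigma> \<subseteq> \<Sigma>''"
      using C by (auto simp: conf_typed_def)
    \<comment> \<open>Since a step exists, this collection loses nothing: an input on a quantum
      channel carries a qubit of \<open>\<Sigma>''\<close>, and no other action enlarges the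
      context.\<close>
    have "EQubit ` \<Sigma>' = ctx_after \<mu> (EQubit ` \<Sigma>) \<and> \<Sigma>' \<subseteq> \<Sigma>''"
    proof (cases \<mu>)
      case (In c v)
      have "\<exists>q \<in> \<Sigma>''. v = VQubit q" if "chan_type c = TQubit"
        using step_in_qubit[OF st[unfolded In] that] sub by simp
      then show ?thesis using sub by (auto simp: \<Sigma>'_def In)
    qed (use sub in \<open>auto simp: \<Sigma>'_def\<close>)
    with step_preserves_typing[OF st ty C'] sub show ?thesis by (simp add: conf_typed_def)
  qed
  then show ?thesis unfolding dist_typed_def by blast
qed

end
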